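(* Let $\tau>0$ and consider the free-running dynamics $\Psi(q)$, $q\in\mathbb{R}^N$, and its Hadamard variance $\sigma^2_{\mathsf H}(\tau;\Psi(q))$ as defined in the context. Then the weight vector solving the optimization problem $$q_{\mathsf H}(\tau):=\operatorname*{arg\,min}_{q\in\mathbb{R}^N}\ \sigma^2_{\mathsf H}(\tau;\Psi(q))\quad\text{subject to}\quad q^\top\mathbb{1}_N=1$$ is $$q_{\mathsf H}(\tau)=\frac{\Pi^{-1}(\tau)\mathbb{1}_N}{\mathbb{1}_N^\top\Pi^{-1}(\tau)\mathbb{1}_N},\qquad \Pi(\tau)=\tau\Sigma_1+\frac{\tau^3}{6}\Sigma_2+\frac{13\tau^5}{360}\Sigma_3.$$
   Context: $N$ and $M$ are integers with $0<M<N$ (an ensemble of $N$ clocks, the last $M$ of which are hydrogen-maser-type and the others cesium-type). $\mathbb{1}_N$ is the all-ones column vector and $\otimes$ the Kronecker product. Let $A=\begin{bmatrix}1&\tau\\0&1\end{bmatrix}$, $C=\begin{bmatrix}1&0\end{bmatrix}$, and $$\Sigma_1=\mathrm{diag}(\sigma_{1,1}^2,\dots,\sigma_{1,N}^2),\quad \Sigma_2=\mathrm{diag}(\sigma_{2,1}^2,\dots,\sigma_{2,N}^2),\quad \Sigma_3=\mathrm{diag}(\underbrace{0,\dots,0}_{N-M},\sigma_{3,N-M+1}^2,\dots,\sigma_{3,N}^2),$$ where the standard deviations $\sigma_{1,i},\sigma_{2,i}$ ($1\le i\le N$) and $\sigma_{3,j}$ ($N-M<j\le N$) are positive. The process $v^x[k]\in\mathbb{R}^{2N}$,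 $k=0,1,\dots$, is zero-mean white Gaussian noise (independent over $k$) with covariance $$Q^x=\begin{bmatrix}\tau\Sigma_1+\frac{\tau^3}{3}\Sigma_2+\frac{\tau^5}{20}\Sigma_3&\frac{\tau^2}{2}\Sigma_2+\frac{\tau^4}{8}\Sigma_3\\ \frac{\tau^2}{2}\Sigma_2+\frac{\tau^4}{8}\Sigma_3&\tau\Sigma_2+\frac{\tau^3}{3}\Sigma_3\end{bmatrix}.$$ For $q\in\mathbb{R}^N$, the free-running dynamics $\Psi(q)$ is $$g[k+1]=Ag[k]+(I_2\otimes q^\top)v^x[k],\qquad h_g[k]=Cg[k],\qquad g[k]\in\mathbb{R}^2.$$ Its Hadamard variance is $$\sigma^2_{\mathsf H}(\tau;\Psi(q)):=\mathbb{E}\left[\frac{(\Delta_1^3h_g[k])^2}{6\tau^2}\right],\qquad \Delta_1^3h_g[k]=h_g[k+3]-3h_g[k+2]+3h_g[k+1]-h_g[k]$$ (this does not depend on $k$ or on the initial state). *)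

theory Defs
  imports
    "HOL-Probability.Probability"
    "Jordan_Normal_Form.Gauss_Jordan_Elimination"
begin

no_notation inner (infix \<open>\<bullet>\<close> 70)
no_notation vec_nth (infixl \<open>$\<close> 90)

subsection \<open>Matrices and vectors\<close>

definition ones :: "nat \<Rightarrow> real vec" where
  "ones N = Matrix.vec N (\<lambda>_. 1)"

definition kronecker :: "real mat \<Rightarrow> real mat \<Rightarrow> real mat" where
  "kronecker A B =
     Matrix.mat (dim_row A * dim_row B) (dim_col A * dim_col B)
       (\<lambda>(i, j). A $$ (i div dim_row B, j div dim_col B) * B $$ (i mod dim_row B, j mod dim_col B))"

(* Only meaningful for invertible A: mat_inverse returns None otherwise. *)
definition inv_mat :: "real mat \<Rightarrow> real mat" where
  "inv_mat A = the (mat_inverse A)"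

subsection \<open>Gaussian random vectors and white noise\<close>

(* A random vector is Gaussian if all its linear combinations are univariate normal,
   where the normal law with standard deviation 0 is a point mass. *)
definition gaussian_random_vector :: "'w measure \<Rightarrow> nat \<Rightarrow> ('w \<Rightarrow> real vec) \<Rightarrow> bool" where
  "gaussian_random_vector P n X \<longleftrightarrow>
     (\<forall>\<omega>\<in>space P. X \<omega> \<in> carrier_vec n) \<and>
     (\<forall>i<n. (\<lambda>\<omega>. X \<omega> $ i) \<in> borel_measurable P) \<and>
     (\<forall>a\<in>carrier_vec n. \<exists>\<mu> s. s \<ge> 0 \<and>
        distr P borel (\<lambda>\<omega>. a \<bullet> X \<omega>) =
          (if s = 0 then return borel \<mu> else density lborel (\<lambda>x. ennreal (normal_density \<mu> s x))))"

definition has_mean_vec :: "'w measure \<Rightarrow> nat \<Rightarrow> ('w \<Rightarrow> real vec) \<Rightarrow> real vec \<Rightarrow> bool" where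
  "has_mean_vec P n X m \<longleftrightarrow> m \<in> carrier_vec n \<and>
     (\<forall>i<n. integrable P (\<lambda>\<omega>. X \<omega> $ i) \<and> (\<integral>\<omega>. X \<omega> $ i \<partial>P) = m $ i)"

definition has_covariance_mat :: "'w measure \<Rightarrow> nat \<Rightarrow> ('w \<Rightarrow> real vec) \<Rightarrow> real mat \<Rightarrow> bool" where
  "has_covariance_mat P n X Q \<longleftrightarrow> Q \<in> carrier_mat n n \<and>
     (\<forall>i<n. \<forall>j<n.
        integrable P (\<lambda>\<omega>. (X \<omega> $ i - (\<integral>\<omega>'. X \<omega>' $ i \<partial>P)) * (X \<omega> $ j - (\<integral>\<omega>'. X \<omega>' $ j \<partial>P))) \<and>
        (\<integral>\<omega>. (X \<omega> $ i - (\<integral>\<omega>'. X \<omega>' $ i \<partial>P)) * (X \<omega> $ j - (\<integral>\<omega>'. X \<omega>' $ j \<partial>P)) \<partial>P) = Q $$ (i, j))"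

(* There is no sigma-algebra on real vec, so independence of the vectors is
   expressed for their coordinate tuples in the product space over the indices below n. *)
definition white_gaussian_noise ::
  "'w measure \<Rightarrow> nat \<Rightarrow> real mat \<Rightarrow> (nat \<Rightarrow> 'w \<Rightarrow> real vec) \<Rightarrow> bool" where
  "white_gaussian_noise P n Q v \<longleftrightarrow>
     prob_space P \<and>
     (\<forall>k. gaussian_random_vector P n (v k) \<and> has_mean_vec P n (v k) (0\<^sub>v n) \<and>
          has_covariance_mat P n (v k) Q) \<and>
     prob_space.indep_vars P (\<lambda>_. \<Pi>\<^sub>M i\<in>{..<n}. borel) (\<lambda>k \<omega>. \<lambda>i\<in>{..<n}. v k \<omega> $ i) UNIV"

subsection \<open>The clock ensemble\<close>

(* Clocks are numbered 0, ..., N - 1; the last M of them are those with index >= N - M. *)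

definition Sigma_all :: "nat \<Rightarrow> (nat \<Rightarrow> real) \<Rightarrow> real mat" where
  "Sigma_all N s = mat_diag N (\<lambda>i. (s i)\<^sup>2)"

definition Sigma_last :: "nat \<Rightarrow> nat \<Rightarrow> (nat \<Rightarrow> real) \<Rightarrow> real mat" where
  "Sigma_last N M s = mat_diag N (\<lambda>i. if i < N - M then 0 else (s i)\<^sup>2)"

definition noise_cov :: "real \<Rightarrow> real mat \<Rightarrow> real mat \<Rightarrow> real mat \<Rightarrow> real mat" where
  "noise_cov \<tau> \<Sigma>1 \<Sigma>2 \<Sigma>3 = four_block_mat
     (\<tau> \<cdot>\<^sub>m \<Sigma>1 + (\<tau>^3 / 3) \<cdot>\<^sub>m \<Sigma>2 + (\<tau>^5 / 20) \<cdot>\<^sub>m \<Sigma>3)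
     ((\<tau>^2 / 2) \<cdot>\<^sub>m \<Sigma>2 + (\<tau>^4 / 8) \<cdot>\<^sub>m \<Sigma>3)
     ((\<tau>^2 / 2) \<cdot>\<^sub>m \<Sigma>2 + (\<tau>^4 / 8) \<cdot>\<^sub>m \<Sigma>3)
     (\<tau> \<cdot>\<^sub>m \<Sigma>2 + (\<tau>^3 / 3) \<cdot>\<^sub>m \<Sigma>3)"

definition clock_A :: "real \<Rightarrow> real mat" where
  "clock_A \<tau> = mat_of_rows_list 2 [[1, \<tau>], [0, 1]]"

definition clock_C :: "real mat" where
  "clock_C = mat_of_rows_list 2 [[1, 0]]"

(* One sample path: w is the realised noise sequence and g0 the realised initial state. *)
primrec free_running_state ::
  "real \<Rightarrow> real vec \<Rightarrow> (nat \<Rightarrow> real vec) \<Rightarrow> real vec \<Rightarrow> nat \<Rightarrow> real vec" where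
  "free_running_state \<tau> q w g0 0 = g0"
| "free_running_state \<tau> q w g0 (Suc k) =
     clock_A \<tau> *\<^sub>v free_running_state \<tau> q w g0 k + kronecker (1\<^sub>m 2) (mat_of_row q) *\<^sub>v w k"

definition free_running_output ::
  "real \<Rightarrow> real vec \<Rightarrow> (nat \<Rightarrow> real vec) \<Rightarrow> real vec \<Rightarrow> nat \<Rightarrow> real" where
  "free_running_output \<tau> q w g0 k = (clock_C *\<^sub>v free_running_state \<tau> q w g0 k) $ 0"

definition third_difference :: "(nat \<Rightarrow> real) \<Rightarrow> nat \<Rightarrow> real" where
  "third_difference h k = h (k + 3) - 3 * h (k + 2) + 3 * h (k + 1) - h k"

definition hadamard_variance ::
  "'w measure \<Rightarrow> real \<Rightarrow> (nat \<Rightarrow> 'w \<Rightarrow> real vec) \<Rightarrow> ('w \<Rightarrow> real vec) \<Rightarrow> nat \<Rightarrow> real vec \<Rightarrow> real" where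
  "hadamard_variance P \<tau> v g0 k q =
     (\<integral>\<omega>. (third_difference (free_running_output \<tau> q (\<lambda>j. v j \<omega>) (g0 \<omega>)) k)\<^sup>2 / (6 * \<tau>\<^sup>2) \<partial>P)"

definition Pi_mat :: "real \<Rightarrow> real mat \<Rightarrow> real mat \<Rightarrow> real mat \<Rightarrow> real mat" where
  "Pi_mat \<tau> \<Sigma>1 \<Sigma>2 \<Sigma>3 =
     \<tau> \<cdot>\<^sub>m \<Sigma>1 + (\<tau>^3 / 6) \<cdot>\<^sub>m \<Sigma>2 + (13 * \<tau>^5 / 360) \<cdot>\<^sub>m \<Sigma>3"

end

(* The third difference removes the initial state and leaves three consecutive noise samples,
     q . a[k+2] + q . (tau b[k+1] - 2 a[k+1]) + q . (a[k] - tau b[k]),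
   where v^x = (a, b).  Whiteness kills the cross terms, so with the blocks of Q^x the Hadamard
   variance is q^T Pi q / tau^2.  As Pi is diagonal and positive, completing the square on the
   hyperplane q^T 1 = 1 exhibits the unique minimiser. *)
theory Submission
  imports Defs
begin

section \<open>Second moments of white noise\<close>

lemma white_gaussian_noise_moment:
  assumes noise: "white_gaussian_noise P n Q v" and i: "i < n" and l: "l < n"
  shows "integrable P (\<lambda>\<omega>. v j \<omega> $ i * v j' \<omega> $ l)"
    and "(\<integral>\<omega>. v j \<omega> $ i * v j' \<omega> $ l \<partial>P) = (if j = j' then Q $$ (i, l) else 0)"
proof -
  interpret prob_space P
    using noise by (simp add: white_gaussian_noise_def)
  have mean: "has_mean_vec P n (v k) (0\<^sub>v n)" and cov: "has_covariance_mat P n (v k) Q" for k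
    using noise by (auto simp: white_gaussian_noise_def)
  have indep: "indep_vars (\<lambda>_. \<Pi>\<^sub>M i\<in>{..<n}. borel) (\<lambda>k \<omega>. \<lambda>i\<in>{..<n}. v k \<omega> $ i) UNIV"
    using noise by (simp add: white_gaussian_noise_def)
  have mean0: "integrable P (\<lambda>\<omega>. v k \<omega> $ m)" "(\<integral>\<omega>. v k \<omega> $ m \<partial>P) = 0" if "m < n" for k m
    using mean[of k] that by (auto simp: has_mean_vec_def)
  have "integrable P (\<lambda>\<omega>. v j \<omega> $ i * v j' \<omega> $ l) \<and>
    (\<integral>\<omega>. v j \<omega> $ i * v j' \<omega> $ l \<partial>P) = (if j = j' then Q $$ (i, l) else 0)"
  proof (cases "j = j'")
    case True
    \<comment> \<open>The means vanish, so the centred products in the covariance are the raw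
      products.\<close>
    then show ?thesis
      using cov[of j] i l by (simp add: has_covariance_mat_def mean0)
  next
    case False
    \<comment> \<open>Independence is given for whole coordinate tuples. \<open>f\<close> picks
      coordinate \<open>i\<close> at time \<open>j\<close> and \<open>l\<close> at every other time,
      so evaluation at \<open>f k\<close> is a measurable map giving one independent scalar family.
      Its members at \<open>j\<close> and \<open>j'\<close> are the two factors, and the product of
      their means is zero.\<close>
    define f where "f k = (if k = j then i else l)" for k
    have f: "f k < n" for k
      using i l by (simp add: f_def)
    have "indep_vars (\<lambda>_. borel) (\<lambda>k \<omega>. (\<lambda>x. x (f k)) ((\<lambda>i\<in>{..<n}. v k \<omega> $ i))) UNIV"
      by (rule indep_vars_compose2[OF indep]) (use f in simp)
    then have "indep_vars (\<lambda>_. borel) (\<lambda>k \<omega>. v k \<omega> $ f k) UNIV"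
      using f by simp
    then have I: "indep_vars (\<lambda>_. borel) (\<lambda>k \<omega>. v k \<omega> $ f k) {j, j'}"
      by (rule indep_vars_subset) simp
    have int: "integrable P (\<lambda>\<omega>. v k \<omega> $ f k)" for k
      using mean0 f by simp
    show ?thesis
      using indep_vars_integrable[OF _ I int] indep_vars_lebesgue_integral[OF _ I int] False
      by (simp add: f_def mean0 i l)
  qed
  then show "integrable P (\<lambda>\<omega>. v j \<omega> $ i * v j' \<omega> $ l)"
    and "(\<integral>\<omega>. v j \<omega> $ i * v j' \<omega> $ l \<partial>P) = (if j = j' then Q $$ (i, l) else 0)"
    by auto
qed

text \<open>Bilinearity reduces this to the coordinate moments: both inner products are expanded,
  the integral passes through the finite double sum, and at equal times the entries of
  \<open>Q\<close> reassemble into the bilinear form.\<close>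

lemma white_gaussian_noise_scalar_prod_moment:
  assumes noise: "white_gaussian_noise P n Q v"
    and u: "u \<in> carrier_vec n" and w: "w \<in> carrier_vec n"
  shows "integrable P (\<lambda>\<omega>. (u \<bullet> v j \<omega>) * (w \<bullet> v j' \<omega>))"
    and "(\<integral>\<omega>. (u \<bullet> v j \<omega>) * (w \<bullet> v j' \<omega>) \<partial>P) = (if j = j' then u \<bullet> (Q *\<^sub>v w) else 0)"
proof -
  note moment = white_gaussian_noise_moment[OF noise]
  have dim: "v k \<omega> \<in> carrier_vec n" if "\<omega> \<in> space P" for k \<omega>
    using noise that by (auto simp: white_gaussian_noise_def gaussian_random_vector_def)
  have Q: "Q \<in> carrier_mat n n"
    using noise by (auto simp: white_gaussian_noise_def has_covariance_mat_def)
  \<comment> \<open>\<open>scalar_prod\<close> sums up to the dimension of its second argument, and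
    the dimension of the noise vectors is known only on \<open>space P\<close>; hence the
    restriction on \<open>\<omega>\<close>.\<close>
  have expand: "(u \<bullet> v j \<omega>) * (w \<bullet> v j' \<omega>) =
      (\<Sum>i<n. \<Sum>l<n. u $ i * w $ l * (v j \<omega> $ i * v j' \<omega> $ l))" if "\<omega> \<in> space P" for \<omega>
    using dim[OF that, of j] dim[OF that, of j']
    by (simp add: scalar_prod_def sum_product mult_ac lessThan_atLeast0)
  have int': "integrable P (\<lambda>\<omega>. u $ i * w $ l * (v j \<omega> $ i * v j' \<omega> $ l))" if "i < n" "l < n" for i l
    using that by (intro integrable_mult_right moment(1))
  then have int: "integrable P (\<lambda>\<omega>. \<Sum>i<n. \<Sum>l<n. u $ i * w $ l * (v j \<omega> $ i * v j' \<omega> $ l))"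
    by (intro Bochner_Integration.integrable_sum) simp
  then show "integrable P (\<lambda>\<omega>. (u \<bullet> v j \<omega>) * (w \<bullet> v j' \<omega>))"
    by (simp add: expand cong: Bochner_Integration.integrable_cong)
  have "(\<integral>\<omega>. (u \<bullet> v j \<omega>) * (w \<bullet> v j' \<omega>) \<partial>P) =
      (\<integral>\<omega>. (\<Sum>i<n. \<Sum>l<n. u $ i * w $ l * (v j \<omega> $ i * v j' \<omega> $ l)) \<partial>P)"
    by (intro Bochner_Integration.integral_cong) (simp_all add: expand)
  also have "\<dots> = (\<Sum>i<n. \<Sum>l<n. \<integral>\<omega>. u $ i * w $ l * (v j \<omega> $ i * v j' \<omega> $ l) \<partial>P)"
    using int'
    by (subst Bochner_Integration.integral_sum)
      (force intro!: sum.cong Bochner_Integration.integral_sum Bochner_Integration.integrable_sum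
        simp del: Bochner_Integration.integral_mult_right_zero Bochner_Integration.integral_mult_right
          integrable_mult_right_iff)+
  also have "\<dots> = (\<Sum>i<n. \<Sum>l<n. u $ i * w $ l * (if j = j' then Q $$ (i, l) else 0))"
    by (intro sum.cong refl) (simp add: moment(2))
  also have "\<dots> = (if j = j' then u \<bullet> (Q *\<^sub>v w) else 0)"
    using u w Q
    by (auto simp: scalar_prod_def lessThan_atLeast0 sum_distrib_left mult_ac intro!: sum.cong)
  finally show "(\<integral>\<omega>. (u \<bullet> v j \<omega>) * (w \<bullet> v j' \<omega>) \<partial>P) = (if j = j' then u \<bullet> (Q *\<^sub>v w) else 0)" .
qed

text \<open>The square is a double sum over pairs of times; samples at distinct times are
  uncorrelated, so only the diagonal survives and variances add.\<close>

lemma white_gaussian_noise_sum_second_moment: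
  assumes noise: "white_gaussian_noise P n Q v"
    and fin: "finite J" and u: "\<And>j. j \<in> J \<Longrightarrow> u j \<in> carrier_vec n"
  shows "(\<integral>\<omega>. (\<Sum>j\<in>J. u j \<bullet> v j \<omega>)\<^sup>2 \<partial>P) = (\<Sum>j\<in>J. u j \<bullet> (Q *\<^sub>v u j))"
proof -
  note moment = white_gaussian_noise_scalar_prod_moment[OF noise u u]
  have "(\<integral>\<omega>. (\<Sum>j\<in>J. u j \<bullet> v j \<omega>)\<^sup>2 \<partial>P) =
      (\<integral>\<omega>. (\<Sum>j\<in>J. \<Sum>j'\<in>J. (u j \<bullet> v j \<omega>) * (u j' \<bullet> v j' \<omega>)) \<partial>P)"
    by (simp add: power2_eq_square sum_product)
  also have "\<dots> = (\<Sum>j\<in>J. \<Sum>j'\<in>J. \<integral>\<omega>. (u j \<bullet> v j \<omega>) * (u j' \<bullet> v j' \<omega>) \<partial>P)"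
    by (simp add: moment(1))
  also have "\<dots> = (\<Sum>j\<in>J. \<Sum>j'\<in>J. if j = j' then u j \<bullet> (Q *\<^sub>v u j') else 0)"
    by (simp add: moment(2) cong: sum.cong)
  also have "\<dots> = (\<Sum>j\<in>J. u j \<bullet> (Q *\<^sub>v u j))"
    using fin by simp
  finally show ?thesis .
qed

section \<open>Diagonal matrices and block quadratic forms\<close>

lemma mat_diag_mult_vec:
  assumes "x \<in> carrier_vec n"
  shows "mat_diag n d *\<^sub>v x = Matrix.vec n (\<lambda>i. d i * x $ i :: 'a :: semiring_0)"
proof (rule eq_vecI)
  fix i assume "i < dim_vec (Matrix.vec n (\<lambda>i. d i * x $ i))"
  then have i: "i < n" by simp
  have "(mat_diag n d *\<^sub>v x) $ i = (\<Sum>j<n. (if i = j then d j else 0) * x $ j)"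
    using assms i by (simp add: mat_diag_def scalar_prod_def lessThan_atLeast0)
  also have "\<dots> = (\<Sum>j<n. if i = j then d j * x $ j else 0)"
    by (intro sum.cong) auto
  finally have "(mat_diag n d *\<^sub>v x) $ i = (\<Sum>j<n. if i = j then d j * x $ j else 0)" .
  then show "(mat_diag n d *\<^sub>v x) $ i = Matrix.vec n (\<lambda>i. d i * x $ i) $ i"
    using i by simp
qed (simp add: mat_diag_def)

text \<open>\<open>inv_mat\<close> is informative only once \<open>mat_inverse\<close> is known to
  succeed. The explicit two-sided inverse makes the matrix a unit of the matrix ring, which excludes
  \<open>None\<close>; the result \<open>B\<close> is then a left inverse and coincides with the
  right inverse: B = B (D E) = (B D) E = E.\<close>

lemma inv_mat_mat_diag:
  assumes "\<And>i. i < n \<Longrightarrow> d i \<noteq> 0"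
  shows "inv_mat (mat_diag n d) = mat_diag n (\<lambda>i. 1 / d i)"
proof -
  let ?D = "mat_diag n d" and ?E = "mat_diag n (\<lambda>i. 1 / d i)"
  have D: "?D \<in> carrier_mat n n" and E: "?E \<in> carrier_mat n n"
    by simp_all
  have DE: "?D * ?E = 1\<^sub>m n" and ED: "?E * ?D = 1\<^sub>m n"
    using assms by auto (auto simp: mat_diag_def one_mat_def intro!: eq_matI)
  have "?D \<in> Units (ring_mat TYPE(real) n ())"
    unfolding Units_def using DE ED by (auto simp: ring_mat_simps intro!: bexI[of _ ?E] simp del: mat_diag_diag)
  then obtain B where B: "mat_inverse ?D = Some B"
    using mat_inverse(1)[OF D, where b = "()"] by (cases "mat_inverse ?D") auto
  then have BD: "B * ?D = 1\<^sub>m n" and Bc: "B \<in> carrier_mat n n"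
    using mat_inverse(2)[OF D B] by auto
  have "B = B * (?D * ?E)"
    unfolding DE using Bc by simp
  also have "\<dots> = (B * ?D) * ?E"
    using assoc_mult_mat[OF Bc D E] by simp
  also have "\<dots> = ?E"
    unfolding BD by (rule left_mult_one_mat[OF E])
  finally show ?thesis
    by (simp add: inv_mat_def B)
qed

lemma four_block_mat_quadratic_form:
  fixes A B C D :: "'a :: comm_semiring_0 mat"
  assumes "A \<in> carrier_mat n n" "B \<in> carrier_mat n m" "C \<in> carrier_mat m n" "D \<in> carrier_mat m m"
    and "x \<in> carrier_vec n" "y \<in> carrier_vec m"
  shows "(x @\<^sub>v y) \<bullet> (four_block_mat A B C D *\<^sub>v (x @\<^sub>v y)) =
    x \<bullet> (A *\<^sub>v x) + x \<bullet> (B *\<^sub>v y) + y \<bullet> (C *\<^sub>v x) + y \<bullet> (D *\<^sub>v y)"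
proof -
  have "(x @\<^sub>v y) \<bullet> (four_block_mat A B C D *\<^sub>v (x @\<^sub>v y)) =
      (x @\<^sub>v y) \<bullet> ((A *\<^sub>v x + B *\<^sub>v y) @\<^sub>v (C *\<^sub>v x + D *\<^sub>v y))"
    by (simp add: four_block_mat_mult_vec[OF assms])
  also have "\<dots> = x \<bullet> (A *\<^sub>v x + B *\<^sub>v y) + y \<bullet> (C *\<^sub>v x + D *\<^sub>v y)"
    by (rule scalar_prod_append) (use assms in auto)
  also have "\<dots> = x \<bullet> (A *\<^sub>v x) + x \<bullet> (B *\<^sub>v y) + (y \<bullet> (C *\<^sub>v x) + y \<bullet> (D *\<^sub>v y))"
    using assms by (simp add: scalar_prod_add_distrib[of _ n] scalar_prod_add_distrib[of _ m])
  finally show ?thesis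
    by (simp add: add.assoc)
qed

text \<open>Every block is diagonal, so the form decouples into one binary quadratic form in
  \<open>\<alpha>\<close> and \<open>\<beta>\<close> per clock, weighted by the square of that entry
  of \<open>q\<close>. Vectors with both halves proportional to \<open>q\<close> are the ones that
  multiply a noise sample in the third difference.\<close>

lemma noise_cov_mat_diag_quadratic_form:
  assumes q: "q \<in> carrier_vec N"
  shows "((\<alpha> \<cdot>\<^sub>v q) @\<^sub>v (\<beta> \<cdot>\<^sub>v q)) \<bullet>
      (noise_cov \<tau> (mat_diag N a) (mat_diag N b) (mat_diag N c) *\<^sub>v ((\<alpha> \<cdot>\<^sub>v q) @\<^sub>v (\<beta> \<cdot>\<^sub>v q))) =
    (\<Sum>i<N. (\<alpha>\<^sup>2 * (\<tau> * a i + \<tau>^3 / 3 * b i + \<tau>^5 / 20 * c i)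
      + 2 * \<alpha> * \<beta> * (\<tau>^2 / 2 * b i + \<tau>^4 / 8 * c i)
      + \<beta>\<^sup>2 * (\<tau> * b i + \<tau>^3 / 3 * c i)) * (q $ i)\<^sup>2)"
proof -
  have A: "\<tau> \<cdot>\<^sub>m mat_diag N a + (\<tau>^3 / 3) \<cdot>\<^sub>m mat_diag N b + (\<tau>^5 / 20) \<cdot>\<^sub>m mat_diag N c =
      mat_diag N (\<lambda>i. \<tau> * a i + \<tau>^3 / 3 * b i + \<tau>^5 / 20 * c i)"
    and B: "(\<tau>^2 / 2) \<cdot>\<^sub>m mat_diag N b + (\<tau>^4 / 8) \<cdot>\<^sub>m mat_diag N c =
      mat_diag N (\<lambda>i. \<tau>^2 / 2 * b i + \<tau>^4 / 8 * c i)"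
    and D: "\<tau> \<cdot>\<^sub>m mat_diag N b + (\<tau>^3 / 3) \<cdot>\<^sub>m mat_diag N c =
      mat_diag N (\<lambda>i. \<tau> * b i + \<tau>^3 / 3 * c i)"
    by (auto simp: mat_diag_def intro!: eq_matI)
  have form: "(x \<cdot>\<^sub>v q) \<bullet> (mat_diag N d *\<^sub>v (y \<cdot>\<^sub>v q)) = (\<Sum>i<N. x * y * d i * (q $ i)\<^sup>2)" for x y d
    using q by (auto simp: mat_diag_mult_vec scalar_prod_def lessThan_atLeast0 power2_eq_square
        intro!: sum.cong)
  show ?thesis
    unfolding noise_cov_def A B D
    using q
    by (subst four_block_mat_quadratic_form[of _ N _ N])
      (auto simp: form power2_eq_square algebra_simps simp flip: sum.distrib intro!: sum.cong)
qed

section \<open>Clock dynamics and the third difference\<close>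

lemma clock_A_mult_vec:
  assumes "x \<in> carrier_vec 2"
  shows "clock_A \<tau> *\<^sub>v x = Matrix.vec 2 (\<lambda>i. if i = 0 then x $ 0 + \<tau> * x $ 1 else x $ 1)"
  using assms
  by (intro eq_vecI)
    (auto simp: clock_A_def mat_of_rows_list_def scalar_prod_def less_2_cases_iff numeral_2_eq_2)

lemma clock_C_mult_vec:
  assumes "x \<in> carrier_vec 2"
  shows "(clock_C *\<^sub>v x) $ 0 = x $ 0"
  using assms by (simp add: clock_C_def mat_of_rows_list_def scalar_prod_def numeral_2_eq_2)

text \<open>The Kronecker factor applies \<open>q\<close> to each half of the noise separately.
  Padding \<open>q\<close> with zeros turns both components into inner products with the full noise
  vector, the form to which the moment lemmas apply.\<close>

lemma kronecker_one_mat_of_row_mult_vec: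
  assumes q: "q \<in> carrier_vec N" and w: "w \<in> carrier_vec (2 * N)" and N: "0 < N"
  shows "kronecker (1\<^sub>m 2) (mat_of_row q) *\<^sub>v w =
    Matrix.vec 2 (\<lambda>i. (if i = 0 then q @\<^sub>v 0\<^sub>v N else 0\<^sub>v N @\<^sub>v q) \<bullet> w)"
proof (rule eq_vecI)
  fix i assume "i < dim_vec (Matrix.vec 2 (\<lambda>i. (if i = 0 then q @\<^sub>v 0\<^sub>v N else 0\<^sub>v N @\<^sub>v q) \<bullet> w))"
  then have i: "i = 0 \<or> i = 1" by auto
  \<comment> \<open>The second factor has \<open>N\<close> columns: the quotient of a column index
    tells the half of \<open>w\<close>, the remainder the position inside that half.\<close>
  have div: "l div N = (if l < N then 0 else 1)" "l mod N = (if l < N then l else l - N)"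
    if "l < 2 * N" for l
    using that N by (auto simp: div_nat_eqI mod_if)
  show "(kronecker (1\<^sub>m 2) (mat_of_row q) *\<^sub>v w) $ i =
      Matrix.vec 2 (\<lambda>i. (if i = 0 then q @\<^sub>v 0\<^sub>v N else 0\<^sub>v N @\<^sub>v q) \<bullet> w) $ i"
    using i q w N
    by (auto simp: kronecker_def scalar_prod_def div mat_of_row_def intro!: sum.cong)
qed (simp add: kronecker_def)

text \<open>The state at time \<open>k\<close> contributes a term affine in the number of further
  steps, which the third difference annihilates, and all earlier noise is contained in that state.
  Unrolling three steps leaves the second difference of the noise in the first component plus \<tau>
  times the first difference of the noise in the second.\<close>

lemma third_difference_free_running_output:
  assumes q: "q \<in> carrier_vec N" and w: "\<And>j. w j \<in> carrier_vec (2 * N)"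
    and g: "g \<in> carrier_vec 2" and N: "0 < N"
  shows "third_difference (free_running_output \<tau> q w g) k =
    (q @\<^sub>v 0\<^sub>v N) \<bullet> w (k + 2) + ((-2 \<cdot>\<^sub>v q) @\<^sub>v (\<tau> \<cdot>\<^sub>v q)) \<bullet> w (k + 1) + (q @\<^sub>v (- \<tau> \<cdot>\<^sub>v q)) \<bullet> w k"
proof -
  let ?s = "free_running_state \<tau> q w g"
  define a b where "a j = (q @\<^sub>v 0\<^sub>v N) \<bullet> w j" and "b j = (0\<^sub>v N @\<^sub>v q) \<bullet> w j" for j
  have s: "?s j \<in> carrier_vec 2" for j
  \<comment> \<open>A vector sum takes the dimension of its second summand, here the noise term with
    two rows, so no induction is required.\<close>
  proof (cases j)
    case (Suc i)
    have "dim_vec (?s j) = 2"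
      by (simp add: Suc kronecker_def)
    then show ?thesis
      by (rule carrier_vecI)
  qed (simp add: g)
  have step: "?s (Suc j) $ 0 = ?s j $ 0 + \<tau> * ?s j $ 1 + a j" "?s (Suc j) $ 1 = ?s j $ 1 + b j" for j
    unfolding free_running_state.simps clock_A_mult_vec[OF s]
      kronecker_one_mat_of_row_mult_vec[OF q w N] a_def b_def
    by simp_all
  have out: "free_running_output \<tau> q w g j = ?s j $ 0" for j
    by (simp add: free_running_output_def clock_C_mult_vec[OF s])
  have comb: "((\<alpha> \<cdot>\<^sub>v q) @\<^sub>v (\<beta> \<cdot>\<^sub>v q)) \<bullet> w j = \<alpha> * a j + \<beta> * b j" for \<alpha> \<beta> j
  proof -
    have "(\<alpha> \<cdot>\<^sub>v q) @\<^sub>v (\<beta> \<cdot>\<^sub>v q) = \<alpha> \<cdot>\<^sub>v (q @\<^sub>v 0\<^sub>v N) + \<beta> \<cdot>\<^sub>v (0\<^sub>v N @\<^sub>v q)"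
      using q by (intro eq_vecI) auto
    moreover have "q @\<^sub>v 0\<^sub>v N \<in> carrier_vec (2 * N)" "0\<^sub>v N @\<^sub>v q \<in> carrier_vec (2 * N)"
      using q by (auto simp: mult_2)
    ultimately show ?thesis
      using w[of j] by (simp add: a_def b_def add_scalar_prod_distrib[of _ "2 * N"])
  qed
  have comb1: "(q @\<^sub>v (\<beta> \<cdot>\<^sub>v q)) \<bullet> w j = a j + \<beta> * b j" for \<beta> j
    using comb[of 1 \<beta> j] by simp
  have idx: "k + 1 = Suc k" "k + 2 = Suc (Suc k)" "k + 3 = Suc (Suc (Suc k))"
    by simp_all
  have "third_difference (free_running_output \<tau> q w g) k =
      a (k + 2) + (-2 * a (k + 1) + \<tau> * b (k + 1)) + (a k + - \<tau> * b k)"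
    unfolding third_difference_def out idx step by (simp add: algebra_simps)
  then show ?thesis
    by (simp only: comb comb1 flip: a_def)
qed

section \<open>The Hadamard variance as a quadratic form\<close>

lemma hadamard_variance_mat_diag:
  fixes N :: nat
  assumes noise: "white_gaussian_noise P (2 * N) (noise_cov \<tau> (mat_diag N a) (mat_diag N b) (mat_diag N c)) v"
    and q: "q \<in> carrier_vec N" and N: "0 < N" and \<tau>: "\<tau> \<noteq> 0"
    and g0: "\<And>\<omega>. \<omega> \<in> space P \<Longrightarrow> g0 \<omega> \<in> carrier_vec 2"
  shows "hadamard_variance P \<tau> v g0 k q =
    (\<Sum>i<N. (\<tau> * a i + \<tau>^3 / 6 * b i + 13 * \<tau>^5 / 360 * c i) * (q $ i)\<^sup>2) / \<tau>\<^sup>2"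
proof -
  let ?Q = "noise_cov \<tau> (mat_diag N a) (mat_diag N b) (mat_diag N c)"
  \<comment> \<open>The coefficient pairs at times \<open>k\<close>, \<open>k + 1\<close>,
    \<open>k + 2\<close> are (1, -\<tau>), (-2, \<tau>) and (1, 0).\<close>
  define \<alpha> where "\<alpha> j = (if j = k + 1 then - 2 else 1 :: real)" for j
  define \<beta> where "\<beta> j = (if j = k then - \<tau> else if j = k + 1 then \<tau> else 0)" for j
  define u where "u j = (\<alpha> j \<cdot>\<^sub>v q) @\<^sub>v (\<beta> j \<cdot>\<^sub>v q)" for j
  have dim: "v j \<omega> \<in> carrier_vec (2 * N)" if "\<omega> \<in> space P" for j \<omega>
    using noise that by (auto simp: white_gaussian_noise_def gaussian_random_vector_def)
  have u: "u j \<in> carrier_vec (2 * N)" for j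
    using q by (auto simp: u_def mult_2)
  have zero: "0 \<cdot>\<^sub>v q = 0\<^sub>v N"
    using q by auto
  have diff: "third_difference (free_running_output \<tau> q (\<lambda>j. v j \<omega>) (g0 \<omega>)) k =
      (\<Sum>j\<in>{k, k + 1, k + 2}. u j \<bullet> v j \<omega>)" if "\<omega> \<in> space P" for \<omega>
    using third_difference_free_running_output[OF q dim[OF that] g0[OF that] N, where \<tau> = \<tau> and k = k]
    by (simp add: u_def \<alpha>_def \<beta>_def zero)
  have "hadamard_variance P \<tau> v g0 k q =
      (\<integral>\<omega>. (\<Sum>j\<in>{k, k + 1, k + 2}. u j \<bullet> v j \<omega>)\<^sup>2 / (6 * \<tau>\<^sup>2) \<partial>P)"
    unfolding hadamard_variance_def by (intro Bochner_Integration.integral_cong) (simp_all only: diff)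
  also have "\<dots> = (\<integral>\<omega>. (\<Sum>j\<in>{k, k + 1, k + 2}. u j \<bullet> v j \<omega>)\<^sup>2 \<partial>P) / (6 * \<tau>\<^sup>2)"
    by (rule Bochner_Integration.integral_divide_zero)
  also have "(\<integral>\<omega>. (\<Sum>j\<in>{k, k + 1, k + 2}. u j \<bullet> v j \<omega>)\<^sup>2 \<partial>P) =
      (\<Sum>j\<in>{k, k + 1, k + 2}. u j \<bullet> (?Q *\<^sub>v u j))"
    by (rule white_gaussian_noise_sum_second_moment[OF noise _ u]) simp
  \<comment> \<open>Let A, B, D be the entries for one clock of the upper left, off-diagonal and
    lower right blocks. The three pairs add up to 6 A - 6 \<tau> B + 2 \<tau>^2 D. In this the
    coefficient of \<open>b i\<close> is (2 - 3 + 2) \<tau>^3 = \<tau>^3, and that of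
    \<open>c i\<close> is (3/10 - 3/4 + 2/3) \<tau>^5 = (13/60) \<tau>^5.\<close>
  also have "\<dots> = (\<Sum>i<N. 6 * ((\<tau> * a i + \<tau>^3 / 6 * b i + 13 * \<tau>^5 / 360 * c i) * (q $ i)\<^sup>2))"
    unfolding u_def noise_cov_mat_diag_quadratic_form[OF q]
    by (simp add: \<alpha>_def \<beta>_def flip: sum.distrib, intro sum.cong refl)
      (simp add: field_simps eval_nat_numeral)
  also have "\<dots> / (6 * \<tau>\<^sup>2) =
      (\<Sum>i<N. (\<tau> * a i + \<tau>^3 / 6 * b i + 13 * \<tau>^5 / 360 * c i) * (q $ i)\<^sup>2) / \<tau>\<^sup>2"
    by (simp flip: sum_distrib_left)
  finally show ?thesis .
qed

section \<open>Constrained minimisation and the optimal weights\<close>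

lemma weighted_sum_squares_complete_square:
  fixes d x :: "'i \<Rightarrow> real"
  assumes d: "\<And>i. i \<in> I \<Longrightarrow> d i \<noteq> 0" and sum1: "sum x I = 1"
    and S: "S = (\<Sum>i\<in>I. 1 / d i)" "S \<noteq> 0"
  shows "(\<Sum>i\<in>I. d i * (x i)\<^sup>2) = 1 / S + (\<Sum>i\<in>I. d i * (x i - 1 / (S * d i))\<^sup>2)"
proof -
  \<comment> \<open>The centre is the Lagrange point, where \<open>d i * x i\<close> is the same for
    all \<open>i\<close>, scaled to total 1. The cross term is then a multiple of
    \<open>sum x I\<close>, hence constant on the hyperplane.\<close>
  have "(\<Sum>i\<in>I. d i * (x i - 1 / (S * d i))\<^sup>2) =
      (\<Sum>i\<in>I. d i * (x i)\<^sup>2 - 2 / S * x i + 1 / S\<^sup>2 * (1 / d i))"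
    using d S(2) by (intro sum.cong refl) (simp add: field_simps power2_eq_square)
  also have "\<dots> = (\<Sum>i\<in>I. d i * (x i)\<^sup>2) - 2 / S * sum x I + 1 / S\<^sup>2 * S"
    by (simp only: sum.distrib sum_subtractf S(1) flip: sum_distrib_left)
  finally show ?thesis
    using sum1 S(2) by (simp add: power2_eq_square)
qed


theorem theorem3:
  fixes N M k :: nat and \<tau> :: real
    and \<sigma>1 \<sigma>2 \<sigma>3 :: "nat \<Rightarrow> real"
    and \<Sigma>1 \<Sigma>2 \<Sigma>3 :: "real mat"
    and P :: "'w measure"
    and v :: "nat \<Rightarrow> 'w \<Rightarrow> real vec"
    and g0 :: "real vec \<Rightarrow> 'w \<Rightarrow> real vec"
  assumes "0 < M" and "M < N" and "\<tau> > 0"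
    and "\<And>i. i < N \<Longrightarrow> \<sigma>1 i > 0"
    and "\<And>i. i < N \<Longrightarrow> \<sigma>2 i > 0"
    and "\<And>j. N - M \<le> j \<Longrightarrow> j < N \<Longrightarrow> \<sigma>3 j > 0"
    and "\<Sigma>1 = Sigma_all N \<sigma>1"
    and "\<Sigma>2 = Sigma_all N \<sigma>2"
    and "\<Sigma>3 = Sigma_last N M \<sigma>3"
    and "white_gaussian_noise P (2 * N) (noise_cov \<tau> \<Sigma>1 \<Sigma>2 \<Sigma>3) v"
    and "\<And>q \<omega>. q \<in> carrier_vec N \<Longrightarrow> \<omega> \<in> space P \<Longrightarrow> g0 q \<omega> \<in> carrier_vec 2"
  shows "{q. is_arg_min (\<lambda>q. hadamard_variance P \<tau> v (g0 q) k q)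
               (\<lambda>q. q \<in> carrier_vec N \<and> scalar_prod q (ones N) = 1) q} =
         {(1 / scalar_prod (ones N) (inv_mat (Pi_mat \<tau> \<Sigma>1 \<Sigma>2 \<Sigma>3) *\<^sub>v ones N)) \<cdot>\<^sub>v
            (inv_mat (Pi_mat \<tau> \<Sigma>1 \<Sigma>2 \<Sigma>3) *\<^sub>v ones N)}"
proof -
  have N: "0 < N" and \<tau>: "\<tau> > 0"
    using assms by auto
  define s3 where "s3 i = (if i < N - M then 0 else (\<sigma>3 i)\<^sup>2)" for i
  \<comment> \<open>\<open>d\<close> is the diagonal of \<open>Pi_mat\<close>, \<open>S\<close> the
    denominator of the claimed weights, and \<open>r\<close> these weights entry by entry.\<close>
  define d where "d i = \<tau> * (\<sigma>1 i)\<^sup>2 + \<tau>^3 / 6 * (\<sigma>2 i)\<^sup>2 + 13 * \<tau>^5 / 360 * s3 i" for i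
  define S where "S = (\<Sum>i<N. 1 / d i)"
  define r where "r = Matrix.vec N (\<lambda>i. 1 / (S * d i))"
  define F where "F q = hadamard_variance P \<tau> v (g0 q) k q" for q
  let ?C = "\<lambda>q. q \<in> carrier_vec N \<and> scalar_prod q (ones N) = 1"
  have \<Sigma>: "\<Sigma>1 = mat_diag N (\<lambda>i. (\<sigma>1 i)\<^sup>2)" "\<Sigma>2 = mat_diag N (\<lambda>i. (\<sigma>2 i)\<^sup>2)" "\<Sigma>3 = mat_diag N s3"
    using assms(7-9) by (simp_all add: Sigma_all_def Sigma_last_def s3_def[abs_def])
  have d_pos: "d i > 0" if "i < N" for i
  proof -
    \<comment> \<open>Since \<open>s3\<close> is zero on the cesium clocks, strict positivity is
      taken from the first term.\<close>
    have "\<tau> * (\<sigma>1 i)\<^sup>2 > 0" "\<tau>^3 / 6 * (\<sigma>2 i)\<^sup>2 \<ge> 0" "13 * \<tau>^5 / 360 * s3 i \<ge> 0"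
      using assms(4)[OF that] \<tau> by (auto simp: s3_def)
    then show ?thesis
      unfolding d_def by linarith
  qed
  have S: "S > 0"
    unfolding S_def using N d_pos by (intro sum_pos) auto
  have ones: "scalar_prod q (ones N) = (\<Sum>i<N. q $ i)" for q
    by (simp add: scalar_prod_def ones_def lessThan_atLeast0)
  have r: "?C r"
  proof -
    have "(\<Sum>i<N. 1 / (S * d i)) = (\<Sum>i<N. 1 / d i) / S"
      by (simp add: sum_divide_distrib mult.commute)
    then show ?thesis
      using S by (simp add: ones r_def flip: S_def)
  qed
  have F: "F q = (1 / S + (\<Sum>i<N. d i * (q $ i - r $ i)\<^sup>2)) / \<tau>\<^sup>2" if "?C q" for q
  proof -
    \<comment> \<open>The variance formula is free of the initial state, so it holds uniformly
      although \<open>g0 q\<close> may vary with \<open>q\<close>.\<close>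
    have "F q = (\<Sum>i<N. d i * (q $ i)\<^sup>2) / \<tau>\<^sup>2"
      unfolding F_def d_def
      using hadamard_variance_mat_diag[OF assms(10)[unfolded \<Sigma>] _ N, of q "g0 q" k] assms(11) that \<tau>
      by simp
    also have "(\<Sum>i<N. d i * (q $ i)\<^sup>2) = 1 / S + (\<Sum>i<N. d i * (q $ i - 1 / (S * d i))\<^sup>2)"
      using d_pos that S
      by (intro weighted_sum_squares_complete_square) (auto simp: ones S_def less_imp_neq[symmetric])
    finally show ?thesis
      by (simp add: r_def)
  qed
  have F_less: "F r < F q" if q: "?C q" and neq: "q \<noteq> r" for q
  proof -
    \<comment> \<open>Equal dimensions force distinct vectors to differ in some entry, and that
      entry makes the weighted distance positive.\<close>
    obtain i where i: "i < N" "q $ i \<noteq> r $ i"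
      using q neq r by (metis carrier_vecD eq_vecI)
    have "0 < (\<Sum>i<N. d i * (q $ i - r $ i)\<^sup>2)"
      using i d_pos by (intro sum_pos2[of _ i]) (auto simp: less_imp_le)
    then show ?thesis
      using \<tau> unfolding F[OF q] F[OF r] by (intro divide_strict_right_mono) auto
  qed
  have argmin: "{q. is_arg_min F ?C q} = {r}"
  proof -
    \<comment> \<open>\<open>is_arg_min\<close> says only that no feasible point has a smaller
      value; the strict inequality \<open>F_less\<close> yields both existence and
      uniqueness.\<close>
    have "is_arg_min F ?C r"
      unfolding is_arg_min_def using r F_less by (metis order.asym order.irrefl)
    moreover have "q = r" if "is_arg_min F ?C q" for q
      using that r F_less unfolding is_arg_min_def by blast
    ultimately show ?thesis
      by blast
  qed
  \<comment> \<open>It remains to recognise \<open>r\<close> in the matrix formula: by diagonality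
    the inverse applied to \<open>ones N\<close> has entries \<open>1 / d i\<close>, which add up to
    \<open>S\<close>.\<close>
  have "Pi_mat \<tau> \<Sigma>1 \<Sigma>2 \<Sigma>3 = mat_diag N d"
    by (auto simp: Pi_mat_def \<Sigma> mat_diag_def d_def intro!: eq_matI)
  then have "inv_mat (Pi_mat \<tau> \<Sigma>1 \<Sigma>2 \<Sigma>3) *\<^sub>v ones N = Matrix.vec N (\<lambda>i. 1 / d i)"
    using d_pos by (auto simp: inv_mat_mat_diag less_imp_neq[symmetric] mat_diag_mult_vec ones_def)
  moreover have "scalar_prod (ones N) (Matrix.vec N (\<lambda>i. 1 / d i)) = S"
    by (simp add: scalar_prod_def ones_def S_def lessThan_atLeast0)
  ultimately show ?thesis
    using argmin unfolding F_def by (auto simp: r_def)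
qed

end
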